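(* Let $q\ge 3$ be a prime such that $p=\frac{q-1}{2}$ is odd. Then the mixed graph $G_{p,q}$ (defined in the context) is a $\left[\frac{p+1}{2},\,q;\,6\right]$-mixed graph; that is, every vertex of $G_{p,q}$ has exactly $\frac{p+1}{2}$ in-arcs, exactly $\frac{p+1}{2}$ out-arcs and exactly $q$ edges, and $G_{p,q}$ has girth $6$.
   Context: Mixed graphs. A mixed graph $G=(V;E\cup A)$ has a finite vertex set $V$, a set $E$ of (undirected) edges $uv$ and a set $A$ of arcs $(u,v)$; it is simple: no parallel arcs, no parallel edges, and no arc parallel to an edge. Walks, paths and cycles are sequences of vertices in which each consecutive pair $v_i,v_{i+1}$ is joined by the arc $(v_i,v_{i+1})$ or by the edge $v_iv_{i+1}$ (arcs are traversed in their direction, edges in either direction; a cycle is closed, has no repeated vertices, and traversing a single edge back and forth is not a cycle). The girth is the length of a shortest cycle. For $z,r\ge 0$, a $[z,r;g]$-mixed graph is a mixed graph in which every vertex has exactly $z$ in-arcs, $z$ out-arcs and $r$ edges, and whose girth is $g$. The graph $B_q$. For a prime $q$, $B_q$ is the undirected bipartite graph with $2q^2$ vertices: the points $(x,y)$ with $x,y\in\mathbb{Z}_q$ and the lines $[m,b]$ with $m,b\in\mathbb{Z}_q$; the line $[m,b]$ and the point $(x,y)$ are joined by an edge if and only if $y=mx+b$ in $\mathbb{Z}_q$. Let $B'_q$ be a disjoint copy of $B_q$, with the copy of $[m,b]$ denoted $[m',b']$ and the copy of $(x,y)$ denoted $(x',y')$. The digraphs $C_m$ and $C_x$. Let $p=\frac{q-1}{2}$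 be odd. For $m\in\mathbb{Z}_q$, $C_m$ is the digraph on the $2q$ vertices $\{[m,b]: b\in\mathbb{Z}_q\}\cup\{[m',b']: b\in\mathbb{Z}_q\}$ whose arcs are, for every $b\in\mathbb{Z}_q$ and every $j\in\{1,3,5,\dots,p\}$, $$\left([m,b],\,[m',(b+\tfrac{j-1}{2})']\right)\quad\text{and}\quad \left([m',b'],\,[m,b+\tfrac{j+1}{2}]\right),$$ with sums modulo $q$. For $x\in\mathbb{Z}_q$, $C_x$ is defined in the same way on the points $\{(x,y): y\in\mathbb{Z}_q\}\cup\{(x',y'): y\in\mathbb{Z}_q\}$: its arcs are $\left((x,y),(x',(y+\tfrac{j-1}{2})')\right)$ and $\left((x',y'),(x,y+\tfrac{j+1}{2})\right)$ for $y\in\mathbb{Z}_q$, $j\in\{1,3,\dots,p\}$. The mixed graph $G_{p,q}$ has vertex set $V(B_q)\cup V(B'_q)$, edge set $E(B_q)\cup E(B'_q)$, and arc set $\bigcup_{m\in\mathbb{Z}_q}A(C_m)\cup\bigcup_{x\in\mathbb{Z}_q}A(C_x)$. *)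

theory Defs
  imports "HOL-Computational_Algebra.Primes" "HOL-Library.Extended_Nat"
begin

section \<open>Mixed graphs\<close>

record 'v pre_mixed_graph =
  verts :: "'v set"
  edges :: "'v set set"
  arcs :: "('v \<times> 'v) set"

text \<open>Since \<open>edges\<close> and \<open>arcs\<close> are sets, there are no parallel edges and no parallel arcs.
  Opposite arcs \<open>(u, v)\<close> and \<open>(v, u)\<close> are not parallel; they form a cycle of length 2.\<close>

locale mixed_graph =
  fixes G :: "'v pre_mixed_graph"
  assumes finite_verts: "finite (verts G)"
    and edges_wf: "e \<in> edges G \<Longrightarrow> \<exists>u\<in>verts G. \<exists>v\<in>verts G. u \<noteq> v \<and> e = {u, v}"
    and arcs_wf: "(u, v) \<in> arcs G \<Longrightarrow> u \<in> verts G \<and> v \<in> verts G \<and> u \<noteq> v"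
    and no_arc_parallel_edge: "(u, v) \<in> arcs G \<Longrightarrow> {u, v} \<notin> edges G"

definition in_arcs :: "'v pre_mixed_graph \<Rightarrow> 'v \<Rightarrow> ('v \<times> 'v) set" where
  "in_arcs G v = {a \<in> arcs G. snd a = v}"

definition out_arcs :: "'v pre_mixed_graph \<Rightarrow> 'v \<Rightarrow> ('v \<times> 'v) set" where
  "out_arcs G v = {a \<in> arcs G. fst a = v}"

definition incident_edges :: "'v pre_mixed_graph \<Rightarrow> 'v \<Rightarrow> 'v set set" where
  "incident_edges G v = {e \<in> edges G. v \<in> e}"

definition joined :: "'v pre_mixed_graph \<Rightarrow> 'v \<Rightarrow> 'v \<Rightarrow> bool" where
  "joined G u v \<longleftrightarrow> (u, v) \<in> arcs G \<or> {u, v} \<in> edges G"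

definition walk :: "'v pre_mixed_graph \<Rightarrow> 'v list \<Rightarrow> bool" where
  "walk G vs \<longleftrightarrow> vs \<noteq> [] \<and> set vs \<subseteq> verts G \<and> successively (joined G) vs"

definition walk_length :: "'v list \<Rightarrow> nat" where
  "walk_length vs = length vs - 1"

text \<open>A cycle is listed with its first vertex repeated at the end. As its vertices are otherwise
  distinct, it can traverse one edge back and forth only if its length is 2; the last conjunct
  excludes exactly the case in which both steps of such a walk use the edge.\<close>

definition is_cycle :: "'v pre_mixed_graph \<Rightarrow> 'v list \<Rightarrow> bool" where
  "is_cycle G vs \<longleftrightarrow> walk G vs \<and> walk_length vs \<ge> 1 \<and> hd vs = last vs \<and> distinct (tl vs) \<and>
     (\<forall>u v. vs = [u, v, u] \<longrightarrow> (u, v) \<in> arcs G \<or> (v, u) \<in> arcs G)"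

text \<open>The girth of a mixed graph without cycles is \<open>\<infinity>\<close>.\<close>

definition girth :: "'v pre_mixed_graph \<Rightarrow> enat" where
  "girth G = (INF vs \<in> {vs. is_cycle G vs}. enat (walk_length vs))"

definition zrg_mixed_graph :: "nat \<Rightarrow> nat \<Rightarrow> nat \<Rightarrow> 'v pre_mixed_graph \<Rightarrow> bool" where
  "zrg_mixed_graph z r g G \<longleftrightarrow> mixed_graph G \<and>
     (\<forall>v\<in>verts G. card (in_arcs G v) = z \<and> card (out_arcs G v) = z \<and>
        card (incident_edges G v) = r) \<and>
     girth G = enat g"

section \<open>The graph \<open>B\<^sub>q\<close>\<close>

text \<open>Residues modulo \<open>q\<close> are represented by the integers \<open>0, \<dots>, q - 1\<close>.\<close>

definition Zq :: "nat \<Rightarrow> int set" where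
  "Zq q = {0..<int q}"

text \<open>\<open>Point x y\<close> is the point \<open>(x, y)\<close> and \<open>Line m b\<close> is the line \<open>[m, b]\<close>.\<close>

datatype incidence = Point int int | Line int int

definition Bq :: "nat \<Rightarrow> incidence pre_mixed_graph" where
  "Bq q = \<lparr>
     verts = {Point x y | x y. x \<in> Zq q \<and> y \<in> Zq q} \<union> {Line m b | m b. m \<in> Zq q \<and> b \<in> Zq q},
     edges = {{Line m b, Point x y} | m b x y.
                m \<in> Zq q \<and> b \<in> Zq q \<and> x \<in> Zq q \<and> y \<in> Zq q \<and> y = (m * x + b) mod int q},
     arcs = {} \<rparr>"

section \<open>The mixed graph \<open>G\<^sub>p\<^sub>,\<^sub>q\<close>\<close>

text \<open>In the disjoint union, \<open>Inl v\<close> is the vertex \<open>v\<close> of \<open>B\<^sub>q\<close> and \<open>Inr v\<close> is its copy in \<open>B'\<^sub>q\<close>.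
  The arc set of \<open>C\<^sub>m\<close> is \<open>C_arcs p q (Line m)\<close> and that of \<open>C\<^sub>x\<close> is \<open>C_arcs p q (Point x)\<close>.\<close>

definition C_arcs :: "nat \<Rightarrow> nat \<Rightarrow> (int \<Rightarrow> 'a) \<Rightarrow> (('a + 'a) \<times> ('a + 'a)) set" where
  "C_arcs p q f =
     {(Inl (f b), Inr (f ((b + (j - 1) div 2) mod int q))) | b j.
        b \<in> Zq q \<and> j \<in> {1..int p} \<and> odd j} \<union>
     {(Inr (f b), Inl (f ((b + (j + 1) div 2) mod int q))) | b j.
        b \<in> Zq q \<and> j \<in> {1..int p} \<and> odd j}"

definition Gpq :: "nat \<Rightarrow> nat \<Rightarrow> (incidence + incidence) pre_mixed_graph" where
  "Gpq p q = \<lparr>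
     verts = Inl ` verts (Bq q) \<union> Inr ` verts (Bq q),
     edges = (image Inl) ` edges (Bq q) \<union> (image Inr) ` edges (Bq q),
     arcs = (\<Union>m\<in>Zq q. C_arcs p q (Line m)) \<union> (\<Union>x\<in>Zq q. C_arcs p q (Point x)) \<rparr>"

end

theory Submission
  imports Defs "HOL-Number_Theory.Cong"
begin

text \<open>Send the vertices over \<open>b\<close> to \<open>2 b\<close> in \<open>B\<^sub>q\<close> and to \<open>2 b + 1\<close> in \<open>B'\<^sub>q\<close>, as residues modulo \<open>2 q\<close>.
  Then the arcs of every \<open>C\<^sub>m\<close> and \<open>C\<^sub>x\<close> become the jumps by \<open>1, 3, \<dots>, p\<close>, while an edge between
  \<open>[m, b]\<close> and \<open>(x, y)\<close> is a jump by \<open>\<plusminus> 2 m x\<close>. Edges switch between points and lines and arcs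
  switch between the two copies, so a closed walk has an even number of edges and an even number of
  arcs. In a cycle of length at most 4 containing an arc the jumps along the edges cancel, and the
  jumps along the arcs add up to a number strictly between \<open>0\<close> and \<open>2 q = 4 p + 2\<close>, which is
  impossible. A cycle of four edges is impossible since two lines meet at most once.\<close>

section \<open>Arcs and edges\<close>

text \<open>Each member lists, by second coordinate, the vertices underlying one C_m or one C_x, so
  points and lines share all arguments about arcs.\<close>

definition families :: "nat \<Rightarrow> (int \<Rightarrow> incidence) set" where
  "families q = Line ` Zq q \<union> Point ` Zq q"

lemma families_inject:
  assumes "f \<in> families q" "g \<in> families q"
  shows "f a = g b \<longleftrightarrow> f = g \<and> a = b"
  using assms by (auto simp: families_def dest: fun_cong)

lemma verts_Bq_families: "verts (Bq q) = {f b | f b. f \<in> families q \<and> b \<in> Zq q}"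
proof -
  have "{f b | f b. f \<in> families q \<and> b \<in> Zq q} =
    {f b | f b. f \<in> Line ` Zq q \<and> b \<in> Zq q} \<union> {f b | f b. f \<in> Point ` Zq q \<and> b \<in> Zq q}"
    unfolding families_def by blast
  then show ?thesis by (simp add: Bq_def) blast
qed

lemma families_in_verts: "f \<in> families q \<Longrightarrow> b \<in> Zq q \<Longrightarrow> f b \<in> verts (Bq q)"
  unfolding verts_Bq_families by blast

lemma arcs_Gpq: "arcs (Gpq p q) = (\<Union>f\<in>families q. C_arcs p q f)"
  by (auto simp: Gpq_def families_def)

lemma verts_Gpq: "verts (Gpq p q) = Inl ` verts (Bq q) \<union> Inr ` verts (Bq q)"
  by (simp add: Gpq_def)

lemma edges_Gpq: "edges (Gpq p q) = image Inl ` edges (Bq q) \<union> image Inr ` edges (Bq q)"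
  by (simp add: Gpq_def)

section \<open>Arcs as shifts modulo q\<close>

lemma mod_in_Zq [simp]: "q > 0 \<Longrightarrow> a mod int q \<in> Zq q"
  by (simp add: Zq_def)

text \<open>Writing j = 2 s + 1 for the arcs into the copy and j = 2 s - 1 for the arcs back turns
  the odd j into two intervals of \<open>k\<close> consecutive shifts.\<close>

lemma C_arcs_eq:
  assumes "odd p"
  defines "k \<equiv> (int p + 1) div 2"
  shows "C_arcs p q f =
     {(Inl (f b), Inr (f ((b + s) mod int q))) | b s. b \<in> Zq q \<and> s \<in> {0..<k}} \<union>
     {(Inr (f b), Inl (f ((b + s) mod int q))) | b s. b \<in> Zq q \<and> s \<in> {1..k}}"
proof -
  from \<open>odd p\<close> obtain n where n: "p = 2 * n + 1" by (rule oddE)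
  have k: "k = int n + 1" by (simp add: k_def n)
  have 1: "(\<lambda>j. (j - 1) div 2) ` {j \<in> {1..int p}. odd j} = {0..<k}"
  proof (intro equalityI subsetI)
    fix s assume "s \<in> {0..<k}"
    then show "s \<in> (\<lambda>j. (j - 1) div 2) ` {j \<in> {1..int p}. odd j}"
      by (intro image_eqI[of _ _ "2 * s + 1"]) (auto simp: n k)
  qed (auto simp: n k elim!: oddE)
  have 2: "(\<lambda>j. (j + 1) div 2) ` {j \<in> {1..int p}. odd j} = {1..k}"
  proof (intro equalityI subsetI)
    fix s assume "s \<in> {1..k}"
    then show "s \<in> (\<lambda>j. (j + 1) div 2) ` {j \<in> {1..int p}. odd j}"
      by (intro image_eqI[of _ _ "2 * s - 1"]) (auto simp: n k)
  qed (auto simp: n k elim!: oddE)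
  show ?thesis
    unfolding C_arcs_def 1[symmetric] 2[symmetric] by blast
qed

text \<open>Two numbers in a window of length q differ by less than q, so congruence forces
  equality. The start of the window is free because the shifts begin at 0 in one direction and at 1
  in the other.\<close>

lemma mod_add_inj_on:
  assumes "A \<subseteq> {a..<a + int q}"
  shows "inj_on (\<lambda>s. (b + s) mod int q) A" "inj_on (\<lambda>s. (b - s) mod int q) A"
proof -
  have *: "s = t" if "s \<in> A" "t \<in> A" "int q dvd s - t" for s t
  proof -
    have "s \<in> {a..<a + int q}" "t \<in> {a..<a + int q}" using that assms by blast+
    then have "\<bar>s - t\<bar> < int q" by auto
    then show ?thesis
      using zdvd_not_zless[of "\<bar>s - t\<bar>" "int q"] that(3) by (cases "s = t") simp_all
  qed
  show "inj_on (\<lambda>s. (b + s) mod int q) A"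
    by (rule inj_onI, rule *) (simp_all add: mod_eq_dvd_iff)
  show "inj_on (\<lambda>s. (b - s) mod int q) A"
    by (rule inj_onI, rule sym, rule *) (simp_all add: mod_eq_dvd_iff)
qed

text \<open>Solves for an unknown end: the tail of an arc with given head and shift, or the
  intercept of a line of given slope through a given point.\<close>

lemma mod_add_eq_iff:
  assumes "b \<in> Zq q"
  shows "c \<in> Zq q \<and> b = (c + s) mod int q \<longleftrightarrow> c = (b - s) mod int q"
proof -
  from assms have b: "b mod int q = b" and "q > 0" by (auto simp: Zq_def)
  have "b = (c + s) mod int q" if "c = (b - s) mod int q"
    using that b by (simp add: mod_add_left_eq)
  moreover have "c = (b - s) mod int q" if "c \<in> Zq q" "b = (c + s) mod int q"
    using that by (simp add: mod_diff_left_eq Zq_def)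
  moreover have "c \<in> Zq q" if "c = (b - s) mod int q"
    unfolding that using \<open>q > 0\<close> by (rule mod_in_Zq)
  ultimately show ?thesis by blast
qed

section \<open>Numbers of in-arcs and out-arcs\<close>

context
  fixes p q :: nat
  assumes odd_p: "odd p" and q_eq: "q = 2 * p + 1"
begin

private abbreviation (input) k :: int where "k \<equiv> (int p + 1) div 2"

private lemma k_le: "k \<le> int q"
  by (simp add: q_eq)

lemma out_arcs_Inl:
  assumes "f \<in> families q" "b \<in> Zq q"
  shows "out_arcs (Gpq p q) (Inl (f b)) = (\<lambda>s. (Inl (f b), Inr (f ((b + s) mod int q)))) ` {0..<k}"
  using assms by (auto simp: out_arcs_def arcs_Gpq C_arcs_eq[OF odd_p] families_inject)

lemma out_arcs_Inr:
  assumes "f \<in> families q" "b \<in> Zq q"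
  shows "out_arcs (Gpq p q) (Inr (f b)) = (\<lambda>s. (Inr (f b), Inl (f ((b + s) mod int q)))) ` {1..k}"
  using assms by (auto simp: out_arcs_def arcs_Gpq C_arcs_eq[OF odd_p] families_inject)

lemma in_arcs_Inl:
  assumes "f \<in> families q" "b \<in> Zq q"
  shows "in_arcs (Gpq p q) (Inl (f b)) = (\<lambda>s. (Inr (f ((b - s) mod int q)), Inl (f b))) ` {1..k}"
    (is "?L = ?R")
proof -
  have "?L = {(Inr (f c), Inl (f b)) | c s. s \<in> {1..k} \<and> c \<in> Zq q \<and> b = (c + s) mod int q}"
    using assms by (fastforce simp: in_arcs_def arcs_Gpq C_arcs_eq[OF odd_p] families_inject)
  also have "\<dots> = ?R"
    unfolding mod_add_eq_iff[OF assms(2)] by blast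
  finally show ?thesis .
qed

lemma in_arcs_Inr:
  assumes "f \<in> families q" "b \<in> Zq q"
  shows "in_arcs (Gpq p q) (Inr (f b)) = (\<lambda>s. (Inl (f ((b - s) mod int q)), Inr (f b))) ` {0..<k}"
    (is "?L = ?R")
proof -
  have "?L = {(Inl (f c), Inr (f b)) | c s. s \<in> {0..<k} \<and> c \<in> Zq q \<and> b = (c + s) mod int q}"
    using assms by (fastforce simp: in_arcs_def arcs_Gpq C_arcs_eq[OF odd_p] families_inject)
  also have "\<dots> = ?R"
    unfolding mod_add_eq_iff[OF assms(2)] by blast
  finally show ?thesis .
qed

lemma card_arcs:
  assumes "v \<in> verts (Gpq p q)"
  shows "card (out_arcs (Gpq p q) v) = (p + 1) div 2" "card (in_arcs (Gpq p q) v) = (p + 1) div 2"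
proof -
  have cards: "card {0..<k} = (p + 1) div 2" "card {1..k} = (p + 1) div 2"
    by (auto simp: nat_div_distrib nat_add_distrib)
  have sub: "{0..<k} \<subseteq> {0..<0 + int q}" "{1..k} \<subseteq> {1..<1 + int q}"
    using k_le by auto
  note inj = mod_add_inj_on[OF sub(1)] mod_add_inj_on[OF sub(2)]
  obtain f b where fb: "f \<in> families q" "b \<in> Zq q" "v = Inl (f b) \<or> v = Inr (f b)"
    using assms by (auto simp: verts_Gpq verts_Bq_families)
  note ff = families_inject[OF fb(1) fb(1)]
  have inj_pair: "inj_on (\<lambda>s. (Inl (f b), Inr (f (g s)))) A" "inj_on (\<lambda>s. (Inr (f b), Inl (f (g s)))) A"
    "inj_on (\<lambda>s. (Inl (f (g s)), Inr (f b))) A" "inj_on (\<lambda>s. (Inr (f (g s)), Inl (f b))) A"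
    if "inj_on g A" for g A
    using that by (auto simp: inj_on_def ff)
  show "card (out_arcs (Gpq p q) v) = (p + 1) div 2"
    using fb(3)
    by (elim disjE)
      (simp_all only: out_arcs_Inl[OF fb(1,2)] out_arcs_Inr[OF fb(1,2)] card_image inj_pair inj cards)
  show "card (in_arcs (Gpq p q) v) = (p + 1) div 2"
    using fb(3)
    by (elim disjE)
      (simp_all only: in_arcs_Inl[OF fb(1,2)] in_arcs_Inr[OF fb(1,2)] card_image inj_pair inj cards)
qed

end

section \<open>Numbers of incident edges\<close>

lemma incident_edges_Line:
  assumes "q > 0" "m \<in> Zq q" "b \<in> Zq q"
  shows "incident_edges (Bq q) (Line m b) =
    (\<lambda>x. {Line m b, Point x ((m * x + b) mod int q)}) ` Zq q"
  using assms by (auto simp: incident_edges_def Bq_def)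

lemma incident_edges_Point:
  assumes "q > 0" "x \<in> Zq q" "y \<in> Zq q"
  shows "incident_edges (Bq q) (Point x y) =
    (\<lambda>m. {Line m ((y - m * x) mod int q), Point x y}) ` Zq q"
proof -
  have "incident_edges (Bq q) (Point x y) =
    {{Line m b, Point x y} | m b. m \<in> Zq q \<and> b \<in> Zq q \<and> y = (b + m * x) mod int q}"
    using assms by (auto simp: incident_edges_def Bq_def add.commute)
  also have "\<dots> = (\<lambda>m. {Line m ((y - m * x) mod int q), Point x y}) ` Zq q"
    unfolding mod_add_eq_iff[OF assms(3)] by blast
  finally show ?thesis .
qed

text \<open>A line has exactly one point for every abscissa, and a point lies on exactly one line of
  every slope.\<close>

lemma card_incident_edges_Bq:
  assumes "q > 0" "v \<in> verts (Bq q)"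
  shows "card (incident_edges (Bq q) v) = q"
proof -
  have "card (Zq q) = q" by (simp add: Zq_def)
  moreover have "card (incident_edges (Bq q) v) = card (Zq q)"
  proof (cases v)
    case (Point x y)
    with assms have "x \<in> Zq q" "y \<in> Zq q" by (auto simp: Bq_def)
    then show ?thesis unfolding Point incident_edges_Point[OF \<open>q > 0\<close> \<open>x \<in> Zq q\<close> \<open>y \<in> Zq q\<close>]
      by (intro card_image inj_onI) (auto simp: doubleton_eq_iff)
  next
    case (Line m b)
    with assms have "m \<in> Zq q" "b \<in> Zq q" by (auto simp: Bq_def)
    then show ?thesis unfolding Line incident_edges_Line[OF \<open>q > 0\<close> \<open>m \<in> Zq q\<close> \<open>b \<in> Zq q\<close>]
      by (intro card_image inj_onI) (auto simp: doubleton_eq_iff)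
  qed
  ultimately show ?thesis by simp
qed

lemma card_incident_edges_Gpq:
  assumes "q > 0" "v \<in> verts (Gpq p q)"
  shows "card (incident_edges (Gpq p q) v) = q"
proof -
  consider (Inl) w where "v = Inl w" "w \<in> verts (Bq q)" | (Inr) w where "v = Inr w" "w \<in> verts (Bq q)"
    using assms by (auto simp: verts_Gpq)
  then show ?thesis
  proof cases
    case Inl
    then have "incident_edges (Gpq p q) v = image Inl ` incident_edges (Bq q) w"
      by (auto simp: incident_edges_def edges_Gpq)
    then show ?thesis using Inl assms
      by (simp add: card_image card_incident_edges_Bq inj_on_image_eq_iff inj_on_def inj_image_eq_iff)
  next
    case Inr
    then have "incident_edges (Gpq p q) v = image Inr ` incident_edges (Bq q) w"
      by (auto simp: incident_edges_def edges_Gpq)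
    then show ?thesis using Inr assms
      by (simp add: card_image card_incident_edges_Bq inj_on_image_eq_iff inj_on_def inj_image_eq_iff)
  qed
qed

section \<open>Short cycles\<close>

fun is_line :: "incidence \<Rightarrow> bool" where
  "is_line (Line m b) = True"
| "is_line (Point x y) = False"

text \<open>The coordinate that arcs leave unchanged; for a line it is the slope.\<close>

fun abscissa :: "incidence \<Rightarrow> int" where
  "abscissa (Line m b) = m"
| "abscissa (Point x y) = x"

fun level :: "incidence \<Rightarrow> int" where
  "level (Line m b) = b"
| "level (Point x y) = y"

definition base :: "'a + 'a \<Rightarrow> 'a" where
  "base v = case_sum id id v"

lemma base_simps [simp]: "base (Inl a) = a" "base (Inr a) = a"
  by (simp_all add: base_def)

text \<open>The offset 1 in the second copy absorbs the difference between the shifts (j - 1)/2 and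
  (j + 1)/2, so that both kinds of arc become the jump j.\<close>

definition pos :: "incidence + incidence \<Rightarrow> int" where
  "pos v = 2 * level (base v) + (if isl v then 0 else 1)"

text \<open>Doubling lifts a congruence modulo q to one modulo 2 q, which removes the reduction of
  second coordinates inside \<open>pos\<close>.\<close>

lemma cong_double_mod: "[2 * (a mod int q) + c = 2 * a + c] (mod 2 * int q)"
  unfolding mult_mod_right by (rule cong_add[OF _ cong_refl]) (simp only: cong_def mod_mod_trivial)

lemma arc_GpqD:
  assumes "odd p" "(u, v) \<in> arcs (Gpq p q)"
  shows "isl v \<longleftrightarrow> \<not> isl u" "is_line (base v) = is_line (base u)"
    "abscissa (base v) = abscissa (base u)"
    "\<exists>d\<in>{1..int p}. [pos v = pos u + d] (mod 2 * int q)"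
proof -
  obtain f where f: "f \<in> families q" "(u, v) \<in> C_arcs p q f"
    using assms by (auto simp: arcs_Gpq)
  \<comment> \<open>Kind and first coordinate are constant on a row, so lines and points need not be
    separated below.\<close>
  have "\<exists>l a. \<forall>b. level (f b) = b \<and> is_line (f b) = l \<and> abscissa (f b) = a"
    using f(1) by (auto simp: families_def)
  then obtain l a where level: "level (f b) = b" "is_line (f b) = l" "abscissa (f b) = a" for b
    by blast
  from f(2) show "isl v \<longleftrightarrow> \<not> isl u" "is_line (base v) = is_line (base u)"
    "abscissa (base v) = abscissa (base u)"
    using level by (auto simp: C_arcs_def)
  from f(2) show "\<exists>d\<in>{1..int p}. [pos v = pos u + d] (mod 2 * int q)"
    unfolding C_arcs_def
  proof (elim UnE CollectE exE conjE)
    fix b j assume j: "(u, v) = (Inl (f b), Inr (f ((b + (j - 1) div 2) mod int q)))"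
      "j \<in> {1..int p}" "odd j"
    then have "2 * (b + (j - 1) div 2) + 1 = 2 * b + j" by (auto elim!: oddE)
    note cong_double_mod[of "b + (j - 1) div 2" q 1, unfolded this]
    then have "[pos v = pos u + j] (mod 2 * int q)"
      using j(1) by (simp add: pos_def level)
    then show ?thesis using j by blast
  next
    fix b j assume j: "(u, v) = (Inr (f b), Inl (f ((b + (j + 1) div 2) mod int q)))"
      "j \<in> {1..int p}" "odd j"
    then have "2 * (b + (j + 1) div 2) = 2 * b + 1 + j" by (auto elim!: oddE)
    note cong_double_mod[of "b + (j + 1) div 2" q 0, unfolded add_0_right this]
    then have "[pos v = pos u + j] (mod 2 * int q)"
      using j(1) by (simp add: pos_def level)
    then show ?thesis using j by blast
  qed
qed

text \<open>The congruence is oriented from line to point, since y = m x + b adds m x in that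
  direction and subtracts it in the other.\<close>

lemma edge_GpqD:
  assumes "{u, v} \<in> edges (Gpq p q)"
  shows "isl v = isl u" "is_line (base v) \<longleftrightarrow> \<not> is_line (base u)"
    "is_line (base u) \<Longrightarrow>
      [pos v = pos u + 2 * (abscissa (base u) * abscissa (base v))] (mod 2 * int q)"
proof -
  obtain h e where h: "h = Inl \<or> h = Inr" and "e \<in> edges (Bq q)" and "{u, v} = h ` e"
    using assms unfolding edges_Gpq by blast
  then obtain m b x where uv: "{u, v} = {h (Line m b), h (Point x ((m * x + b) mod int q))}"
    by (auto simp: Bq_def)
  have disj: "u = h (Line m b) \<and> v = h (Point x ((m * x + b) mod int q)) \<or>
      v = h (Line m b) \<and> u = h (Point x ((m * x + b) mod int q))"
    using uv by (auto simp: doubleton_eq_iff)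
  with h show "isl v = isl u" "is_line (base v) \<longleftrightarrow> \<not> is_line (base u)"
    by auto
  show "[pos v = pos u + 2 * (abscissa (base u) * abscissa (base v))] (mod 2 * int q)"
    if "is_line (base u)"
  proof -
    have u: "u = h (Line m b)" and v: "v = h (Point x ((m * x + b) mod int q))"
      using that h disj by auto
    define c :: int where "c = (if isl u then 0 else 1)"
    have "pos v = 2 * ((m * x + b) mod int q) + c" "pos u = 2 * b + c"
      using h by (auto simp: pos_def c_def u v)
    moreover have "abscissa (base u) = m" "abscissa (base v) = x"
      using h by (auto simp: u v)
    ultimately show ?thesis
      using cong_double_mod[of "m * x + b" q c] by (simp add: algebra_simps)
  qed
qed

text \<open>Covers both directions of traversal, in a form that can be added and subtracted along a
  walk.\<close>

lemma edge_GpqD':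
  assumes "{u, v} \<in> edges (Gpq p q)"
  defines "e \<equiv> 2 * (abscissa (base u) * abscissa (base v))"
  shows "2 * int q dvd (if is_line (base u) then pos v - pos u - e else pos u - pos v - e)"
proof (cases "is_line (base u)")
  case True
  with edge_GpqD(3)[OF assms(1)] show ?thesis
    by (simp add: e_def cong_iff_dvd_diff algebra_simps)
next
  case False
  moreover have "{v, u} \<in> edges (Gpq p q)" using assms by (simp add: insert_commute)
  ultimately show ?thesis using edge_GpqD[of v u p q]
    by (auto simp: e_def cong_iff_dvd_diff algebra_simps)
qed

lemma arc_GpqD':
  assumes "odd p" "(u, v) \<in> arcs (Gpq p q)"
  obtains d where "1 \<le> d" "d \<le> int p" "2 * int q dvd pos v - pos u - d"
  using arc_GpqD(4)[OF assms] by (auto simp: cong_iff_dvd_diff algebra_simps)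

section \<open>Well-formedness of the mixed graph\<close>

lemma mixed_graph_Gpq:
  assumes "odd p" "q > 0"
  shows "mixed_graph (Gpq p q)"
proof
  have "verts (Bq q) = (\<lambda>(x, y). Point x y) ` (Zq q \<times> Zq q) \<union> (\<lambda>(x, y). Line x y) ` (Zq q \<times> Zq q)"
    by (auto simp: Bq_def)
  then show "finite (verts (Gpq p q))" by (simp add: verts_Gpq Zq_def)
next
  fix e assume "e \<in> edges (Gpq p q)"
  then obtain h e' where h: "h = Inl \<or> h = Inr" and e': "e' \<in> edges (Bq q)" "e = h ` e'"
    unfolding edges_Gpq by blast
  from e'(1) obtain m b x y where "e' = {Line m b, Point x y}"
    "Line m b \<in> verts (Bq q)" "Point x y \<in> verts (Bq q)"
    by (auto simp: Bq_def)
  with h e'(2) show "\<exists>u\<in>verts (Gpq p q). \<exists>v\<in>verts (Gpq p q). u \<noteq> v \<and> e = {u, v}"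
    by (intro bexI[of _ "h (Line m b)"] bexI[of _ "h (Point x y)"]) (auto simp: verts_Gpq)
next
  fix u v assume a: "(u, v) \<in> arcs (Gpq p q)"
  then have "u \<noteq> v" using arc_GpqD(1)[OF \<open>odd p\<close> a] by auto
  moreover have "u \<in> verts (Gpq p q) \<and> v \<in> verts (Gpq p q)"
    using a assms by (auto simp: arcs_Gpq C_arcs_def verts_Gpq image_iff families_in_verts)
  ultimately show "u \<in> verts (Gpq p q) \<and> v \<in> verts (Gpq p q) \<and> u \<noteq> v" by simp
  \<comment> \<open>An arc changes the copy, an edge stays inside one.\<close>
  show "{u, v} \<notin> edges (Gpq p q)"
    using arc_GpqD(1)[OF \<open>odd p\<close> a] edge_GpqD(1)[of u v p q] by auto
qed

section \<open>Exclusion of closed walks of length 2 and 4\<close>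

lemma Zq_eqI:
  assumes "a \<in> Zq q" "b \<in> Zq q" "int q dvd a - b"
  shows "a = b"
  using assms by (simp add: Zq_def flip: mod_eq_dvd_iff)

text \<open>Within one copy the offsets in \<open>pos\<close> cancel, so \<open>pos\<close> modulo 2
  q determines \<open>level\<close> modulo q.\<close>

lemma verts_Gpq_eqI:
  assumes "u \<in> verts (Gpq p q)" "v \<in> verts (Gpq p q)" "isl u = isl v"
    "is_line (base u) = is_line (base v)" "int q dvd abscissa (base u) - abscissa (base v)"
    "2 * int q dvd pos u - pos v"
  shows "u = v"
proof -
  have coords: "abscissa (base w) \<in> Zq q" "level (base w) \<in> Zq q" if "w \<in> verts (Gpq p q)" for w
    using that by (auto simp: verts_Gpq Bq_def)
  have "2 * int q dvd 2 * (level (base u) - level (base v))"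
    using assms(3,6) by (simp add: pos_def right_diff_distrib)
  then have "int q dvd level (base u) - level (base v)"
    by (subst (asm) dvd_mult_cancel_left) simp
  with assms coords have "level (base u) = level (base v)" "abscissa (base u) = abscissa (base v)"
    by (blast intro: Zq_eqI)+
  then have "base u = base v"
    using assms(4) by (cases "base u"; cases "base v") auto
  with assms(3) show ?thesis by (cases u; cases v) auto
qed

text \<open>\<open>D\<close> is the total jump of at most four arcs. It is positive and smaller than
  2 q = 4 p + 2. The minus sign is what remains when the relations around a closed walk are added
  and the positions telescope.\<close>

lemma not_dvd_arc_sum:
  assumes "q = 2 * p + 1" "2 * int q dvd - D" "1 \<le> D" "D \<le> 4 * int p"
  shows False
  using zdvd_imp_le[of "2 * int q" D] assms by simp

text \<open>In this and the following names, \<open>a\<close> stands for an arc and \<open>e\<close>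
  for an edge, in walking order.\<close>

lemma no_closed_walk_aa:
  assumes "odd p" "q = 2 * p + 1" "(u, v) \<in> arcs (Gpq p q)" "(v, u) \<in> arcs (Gpq p q)"
  shows False
proof -
  obtain d1 where d1: "1 \<le> d1" "d1 \<le> int p" "2 * int q dvd pos v - pos u - d1"
    using arc_GpqD'[OF assms(1,3)] .
  obtain d2 where d2: "1 \<le> d2" "d2 \<le> int p" "2 * int q dvd pos u - pos v - d2"
    using arc_GpqD'[OF assms(1,4)] .
  have "2 * int q dvd - (d1 + d2)"
    using dvd_add[OF d1(3) d2(3)] by (simp add: algebra_simps)
  then show False by (rule not_dvd_arc_sum[OF assms(2)]) (use d1 d2 in simp_all)
qed

lemma no_closed_walk_aaaa:
  assumes "odd p" "q = 2 * p + 1" "(t, u) \<in> arcs (Gpq p q)" "(u, v) \<in> arcs (Gpq p q)"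
    "(v, w) \<in> arcs (Gpq p q)" "(w, t) \<in> arcs (Gpq p q)"
  shows False
proof -
  obtain d1 where d1: "1 \<le> d1" "d1 \<le> int p" "2 * int q dvd pos u - pos t - d1"
    using arc_GpqD'[OF assms(1,3)] .
  obtain d2 where d2: "1 \<le> d2" "d2 \<le> int p" "2 * int q dvd pos v - pos u - d2"
    using arc_GpqD'[OF assms(1,4)] .
  obtain d3 where d3: "1 \<le> d3" "d3 \<le> int p" "2 * int q dvd pos w - pos v - d3"
    using arc_GpqD'[OF assms(1,5)] .
  obtain d4 where d4: "1 \<le> d4" "d4 \<le> int p" "2 * int q dvd pos t - pos w - d4"
    using arc_GpqD'[OF assms(1,6)] .
  have "2 * int q dvd - (d1 + d2 + d3 + d4)"
    using dvd_add[OF dvd_add[OF dvd_add[OF d1(3) d2(3)] d3(3)] d4(3)]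
    by (simp add: algebra_simps)
  then show False by (rule not_dvd_arc_sum[OF assms(2)]) (use d1 d2 d3 d4 in simp_all)
qed

text \<open>The two arcs preserve kind and first coordinate, so \<open>t\<close> and
  \<open>v\<close> agree in both. The edges through \<open>w\<close> therefore carry the same
  product, once with each sign, and cancel.\<close>

lemma no_closed_walk_aaee:
  assumes "odd p" "q = 2 * p + 1" "(t, u) \<in> arcs (Gpq p q)" "(u, v) \<in> arcs (Gpq p q)"
    "{v, w} \<in> edges (Gpq p q)" "{w, t} \<in> edges (Gpq p q)"
  shows False
proof -
  obtain d1 where d1: "1 \<le> d1" "d1 \<le> int p" "2 * int q dvd pos u - pos t - d1"
    using arc_GpqD'[OF assms(1,3)] .
  obtain d2 where d2: "1 \<le> d2" "d2 \<le> int p" "2 * int q dvd pos v - pos u - d2"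
    using arc_GpqD'[OF assms(1,4)] .
  note a = arc_GpqD(2,3)[OF assms(1,3)] arc_GpqD(2,3)[OF assms(1,4)]
  have "2 * int q dvd pos t - pos v"
  proof (cases "is_line (base w)")
    case True
    with a edge_GpqD(2)[OF assms(5)] edge_GpqD'[OF assms(5)] edge_GpqD'[OF assms(6)]
    show ?thesis
      using dvd_diff[of "2 * int q"
          "pos t - pos w - 2 * (abscissa (base w) * abscissa (base t))"
          "pos v - pos w - 2 * (abscissa (base v) * abscissa (base w))"]
      by (simp add: algebra_simps)
  next
    case False
    with a edge_GpqD(2)[OF assms(5)] edge_GpqD'[OF assms(5)] edge_GpqD'[OF assms(6)]
    show ?thesis
      using dvd_diff[of "2 * int q"
          "pos w - pos v - 2 * (abscissa (base v) * abscissa (base w))"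
          "pos w - pos t - 2 * (abscissa (base w) * abscissa (base t))"]
      by (simp add: algebra_simps)
  qed
  from dvd_add[OF dvd_add[OF d1(3) d2(3)] this] have "2 * int q dvd - (d1 + d2)"
    by (simp add: algebra_simps)
  then show False by (rule not_dvd_arc_sum[OF assms(2)]) (use d1 d2 in simp_all)
qed

text \<open>The arcs carry the first coordinates of one edge to those of the other. One edge is
  walked from line to point and the other from point to line, so their jumps cancel.\<close>

lemma no_closed_walk_aeae:
  assumes "odd p" "q = 2 * p + 1" "(t, u) \<in> arcs (Gpq p q)" "{u, v} \<in> edges (Gpq p q)"
    "(v, w) \<in> arcs (Gpq p q)" "{w, t} \<in> edges (Gpq p q)"
  shows False
proof -
  define e where "e a b = 2 * (abscissa (base a) * abscissa (base b))"
    for a b :: "incidence + incidence"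
  note a = arc_GpqD(2,3)[OF assms(1,3)] arc_GpqD(2,3)[OF assms(1,5)]
  obtain d1 where d1: "1 \<le> d1" "d1 \<le> int p" "2 * int q dvd pos u - pos t - d1"
    using arc_GpqD'[OF assms(1,3)] .
  obtain d2 where d2: "1 \<le> d2" "d2 \<le> int p" "2 * int q dvd pos w - pos v - d2"
    using arc_GpqD'[OF assms(1,5)] .
  have "e u v = e w t" using a by (simp add: e_def)
  have "2 * int q dvd pos v - pos u + (pos t - pos w)"
  proof (cases "is_line (base u)")
    case True
    then have "2 * int q dvd pos v - pos u - e u v" "2 * int q dvd pos w - pos t - e w t"
      using a edge_GpqD(2)[OF assms(4)] edge_GpqD'[OF assms(4)] edge_GpqD'[OF assms(6)]
      by (simp_all add: e_def)
    from dvd_diff[OF this] show ?thesis using \<open>e u v = e w t\<close> by (simp add: algebra_simps)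
  next
    case False
    then have "2 * int q dvd pos u - pos v - e u v" "2 * int q dvd pos t - pos w - e w t"
      using a edge_GpqD(2)[OF assms(4)] edge_GpqD'[OF assms(4)] edge_GpqD'[OF assms(6)]
      by (simp_all add: e_def)
    from dvd_diff[OF this(2,1)] show ?thesis using \<open>e u v = e w t\<close> by (simp add: algebra_simps)
  qed
  from dvd_add[OF this dvd_add[OF d1(3) d2(3)]] have "2 * int q dvd - (d1 + d2)"
    by (simp add: algebra_simps)
  then show False by (rule not_dvd_arc_sum[OF assms(2)]) (use d1 d2 in simp_all)
qed

text \<open>The alternating sum of the four edge relations factors as twice (difference of slopes)
  times (difference of abscissas). As q is prime, one factor vanishes modulo q, and a common
  neighbour then identifies the two vertices.\<close>

lemma no_4_cycle_edges:
  assumes "prime q" "{t, u, v, w} \<subseteq> verts (Gpq p q)"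
    "{t, u} \<in> edges (Gpq p q)" "{u, v} \<in> edges (Gpq p q)"
    "{v, w} \<in> edges (Gpq p q)" "{w, t} \<in> edges (Gpq p q)"
  shows "t = v \<or> u = w"
proof -
  \<comment> \<open>A walk starting at a point is reduced to this case by rotating it one
    step.\<close>
  have *: "t = v \<or> u = w" if "is_line (base t)" "{t, u, v, w} \<subseteq> verts (Gpq p q)"
    "{t, u} \<in> edges (Gpq p q)" "{u, v} \<in> edges (Gpq p q)"
    "{v, w} \<in> edges (Gpq p q)" "{w, t} \<in> edges (Gpq p q)" for t u v w
  proof -
    define e where "e a b = 2 * (abscissa (base a) * abscissa (base b))"
      for a b :: "incidence + incidence"
    have kinds: "is_line (base v)" "\<not> is_line (base u)" "\<not> is_line (base w)"
      and copies: "isl t = isl v" "isl u = isl w"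
      using that edge_GpqD(1,2)[OF that(3)] edge_GpqD(1,2)[OF that(4)]
        edge_GpqD(1,2)[OF that(5)] by simp_all
    have tu: "2 * int q dvd pos u - pos t - e t u"
      and uv: "2 * int q dvd pos u - pos v - e u v"
      and vw: "2 * int q dvd pos w - pos v - e v w"
      and wt: "2 * int q dvd pos w - pos t - e w t"
      using that(1) kinds edge_GpqD'[OF that(3)] edge_GpqD'[OF that(4)]
        edge_GpqD'[OF that(5)] edge_GpqD'[OF that(6)] by (simp_all add: e_def)
    have "2 * int q dvd 2 * ((abscissa (base t) - abscissa (base v)) * (abscissa (base u) - abscissa (base w)))"
      using dvd_diff[OF dvd_diff[OF uv tu] dvd_diff[OF vw wt]] by (simp add: e_def algebra_simps)
    then have "int q dvd (abscissa (base t) - abscissa (base v)) * (abscissa (base u) - abscissa (base w))"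
      by (subst (asm) dvd_mult_cancel_left) simp
    then consider "int q dvd abscissa (base t) - abscissa (base v)"
      | "int q dvd abscissa (base u) - abscissa (base w)"
      using \<open>prime q\<close> by (auto simp: prime_dvd_mult_iff)
    then show ?thesis
    proof cases
      case 1
      \<comment> \<open>Equal slopes give equal jumps to the common point \<open>u\<close>, hence
        equal positions of \<open>t\<close> and \<open>v\<close>.\<close>
      then have "2 * int q dvd e t u - e u v"
        by (auto simp: e_def dvd_def algebra_simps)
      from dvd_diff[OF dvd_diff[OF uv tu] this] 1 show ?thesis
        using verts_Gpq_eqI[of t p q v] that(1,2) kinds copies by (simp add: algebra_simps)
    next
      case 2
      then have "2 * int q dvd e t u - e w t"
        by (auto simp: e_def dvd_def algebra_simps)
      from dvd_add[OF dvd_diff[OF tu wt] this] 2 show ?thesis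
        using verts_Gpq_eqI[of u p q w] that(1,2) kinds copies by (simp add: algebra_simps)
    qed
  qed
  show ?thesis
  proof (cases "is_line (base t)")
    case True
    then show ?thesis using * assms by blast
  next
    case False
    then have "is_line (base u)" using edge_GpqD(2)[OF assms(3)] by simp
    then show ?thesis using *[of u v w t] assms by auto
  qed
qed

section \<open>Parity of cycle lengths and the girth\<close>

text \<open>An arc flips only the copy and an edge flips only the kind, so every step changes
  whether the two flags agree. This is a 2-colouring.\<close>

lemma joined_Gpq_parity:
  assumes "odd p" "joined (Gpq p q) u v"
  shows "(isl v = is_line (base v)) \<longleftrightarrow> (isl u \<noteq> is_line (base u))"
  using assms arc_GpqD(1,2)[OF assms(1), of u v q] edge_GpqD(1,2)[of u v p q]
  unfolding joined_def by blast

text \<open>A list has one vertex more than it has steps, so equal end colours mean odd list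
  length.\<close>

lemma successively_parity:
  assumes "successively R vs" "vs \<noteq> []" "\<And>u v. R u v \<Longrightarrow> P v \<longleftrightarrow> \<not> P u"
  shows "P (last vs) = P (hd vs) \<longleftrightarrow> odd (length vs)"
  using assms(1,2) by (induction vs rule: induct_list012) (auto dest: assms(3))

lemma not_is_cycle_4:
  assumes "prime q" "odd p" "q = 2 * p + 1" "is_cycle (Gpq p q) [a, b, c, d, a]"
  shows False
proof -
  let ?A = "\<lambda>u v. (u, v) \<in> arcs (Gpq p q)" and ?E = "\<lambda>u v. {u, v} \<in> edges (Gpq p q)"
  have joined: "?A a b \<or> ?E a b" "?A b c \<or> ?E b c" "?A c d \<or> ?E c d" "?A d a \<or> ?E d a"
    and verts: "{a, b, c, d} \<subseteq> verts (Gpq p q)" and distinct: "a \<noteq> c" "b \<noteq> d"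
    using assms(4) by (auto simp: is_cycle_def walk_def joined_def)
  have A: "isl v \<noteq> isl u" if "?A u v" for u v using arc_GpqD(1)[OF \<open>odd p\<close> that] by simp
  have E: "isl v = isl u" if "?E u v" for u v using edge_GpqD(1)[OF that] by simp
  note aaaa = no_closed_walk_aaaa[OF assms(2,3)]
    and aaee = no_closed_walk_aaee[OF assms(2,3)]
    and aeae = no_closed_walk_aeae[OF assms(2,3)]
  show False
  \<comment> \<open>Three comparisons of copies fix the type of all four steps, because the number
    of copy changes is even. Each of the eight cases is a rotation of one of the excluded
    patterns.\<close>
  proof (cases "isl b = isl a")
    case ab: True
    then have e: "?E a b" using joined(1) A by blast
    show ?thesis
    proof (cases "isl c = isl b")
      case bc: True
      then have e': "?E b c" using joined(2) A by blast
      show ?thesis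
      proof (cases "isl d = isl c")
        case True
        then have "?E c d" "?E d a" using joined(3,4) A ab bc by blast+
        then show ?thesis using no_4_cycle_edges[OF \<open>prime q\<close> verts e e'] distinct by blast
      next
        case False
        then have "?A c d" "?A d a" using joined(3,4) E ab bc by blast+
        then show ?thesis using aaee e e' by blast
      qed
    next
      case bc: False
      then have a': "?A b c" using joined(2) E by blast
      show ?thesis
      proof (cases "isl d = isl c")
        case True
        then have "?E c d" "?A d a" using joined(3,4) A E ab bc by blast+
        then show ?thesis using aeae[of d a b c] e a' by (simp add: insert_commute)
      next
        case False
        then have "?A c d" "?E d a" using joined(3,4) A E ab bc by blast+
        then show ?thesis using aaee e a' by blast
      qed
    qed
  next
    case ab: False
    then have a: "?A a b" using joined(1) E by blast
    show ?thesis
    proof (cases "isl c = isl b")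
      case bc: True
      then have e': "?E b c" using joined(2) A by blast
      show ?thesis
      proof (cases "isl d = isl c")
        case True
        then have "?E c d" "?A d a" using joined(3,4) A E ab bc by blast+
        then show ?thesis using aaee a e' by blast
      next
        case False
        then have "?A c d" "?E d a" using joined(3,4) A E ab bc by blast+
        then show ?thesis using aeae a e' by blast
      qed
    next
      case bc: False
      then have a': "?A b c" using joined(2) E by blast
      show ?thesis
      proof (cases "isl d = isl c")
        case True
        then have "?E c d" "?E d a" using joined(3,4) A E ab bc by blast+
        then show ?thesis using aaee a a' by blast
      next
        case False
        then have "?A c d" "?A d a" using joined(3,4) A E ab bc by blast+
        then show ?thesis using aaaa a a' by blast
      qed
    qed
  qed
qed

text \<open>Parity leaves only lengths 2 and 4, that is, lists of 3 and 5 vertices.\<close>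

lemma cycle_length_ge_6:
  assumes "prime q" "odd p" "q = 2 * p + 1" "is_cycle (Gpq p q) vs"
  shows "walk_length vs \<ge> 6"
proof (rule ccontr)
  interpret mixed_graph "Gpq p q"
    by (rule mixed_graph_Gpq) (use assms in simp_all)
  assume "\<not> walk_length vs \<ge> 6"
  have vs: "successively (joined (Gpq p q)) vs" "vs \<noteq> []" "hd vs = last vs" "length vs - 1 \<ge> 1"
    using assms(4) by (auto simp: is_cycle_def walk_def walk_length_def)
  have "odd (length vs)"
    using successively_parity[OF vs(1,2), of "\<lambda>v. isl v = is_line (base v)"]
      joined_Gpq_parity[OF assms(2)] vs(3) by simp
  moreover have "length vs \<le> 6" "length vs \<noteq> 1"
    using \<open>\<not> walk_length vs \<ge> 6\<close> vs(4) by (auto simp: walk_length_def)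
  ultimately have "length vs = 3 \<or> length vs = 5"
    by presburger
  then show False
  proof
    assume "length vs = 3"
    then obtain a b where ab: "vs = [a, b, a]"
      using vs(3) by (auto simp: numeral_eq_Suc length_Suc_conv)
    then have "(a, b) \<in> arcs (Gpq p q) \<or> (b, a) \<in> arcs (Gpq p q)"
      "joined (Gpq p q) a b" "joined (Gpq p q) b a"
      using assms(4) by (auto simp: is_cycle_def walk_def)
    \<comment> \<open>One arc between \<open>a\<close> and \<open>b\<close> rules out an edge there,
      so the other step is an arc too.\<close>
    then have "(a, b) \<in> arcs (Gpq p q) \<and> (b, a) \<in> arcs (Gpq p q)"
      using no_arc_parallel_edge[of a b] no_arc_parallel_edge[of b a]
      by (auto simp: joined_def insert_commute)
    then show False using no_closed_walk_aa[OF assms(2,3)] by blast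
  next
    assume "length vs = 5"
    then obtain a b c d where "vs = [a, b, c, d, a]"
      using vs(3) by (auto simp: numeral_eq_Suc length_Suc_conv)
    then show False using not_is_cycle_4 assms by blast
  qed
qed

text \<open>The three lines \<open>y = 0\<close>, \<open>y = x\<close> and \<open>y = 2 x - 2\<close> meet pairwise in \<open>(0, 0)\<close>, \<open>(2, 2)\<close>
  and \<open>(1, 0)\<close>.\<close>

lemma ex_6_cycle:
  assumes "q \<ge> 3"
  obtains vs where "is_cycle (Gpq p q) vs" "walk_length vs = 6"
proof -
  let ?vs = "map Inl [Line 0 0, Point 0 0, Line 1 0, Point 2 2, Line 2 (int q - 2), Point 1 0, Line 0 0]
    :: (incidence + incidence) list"
  \<comment> \<open>\<open>int q - 2\<close> represents the intercept -2. For q = 3 the residues 0,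
    1, 2 are still distinct.\<close>
  have Z: "0 \<in> Zq q" "1 \<in> Zq q" "2 \<in> Zq q" "int q - 2 \<in> Zq q"
    using assms by (auto simp: Zq_def)
  have J: "joined (Gpq p q) (Inl (Line m b)) (Inl (Point x y))"
    "joined (Gpq p q) (Inl (Point x y)) (Inl (Line m b))"
    if "m \<in> Zq q" "b \<in> Zq q" "x \<in> Zq q" "y \<in> Zq q" "(m * x + b) mod int q = y" for m b x y
  proof -
    have "{Line m b, Point x y} \<in> edges (Bq q)" using that by (auto simp: Bq_def)
    then have "Inl ` {Line m b, Point x y} \<in> edges (Gpq p q)" by (simp only: edges_Gpq UnI1 imageI)
    then show "joined (Gpq p q) (Inl (Line m b)) (Inl (Point x y))"
      "joined (Gpq p q) (Inl (Point x y)) (Inl (Line m b))"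
      by (simp_all add: joined_def insert_commute)
  qed
  have "(2::int) mod int q = 2"
    using assms by simp
  with Z have "successively (joined (Gpq p q)) ?vs"
    by (simp add: J)
  moreover have "set ?vs \<subseteq> verts (Gpq p q)"
    using Z by (auto simp: verts_Gpq Bq_def)
  ultimately have "is_cycle (Gpq p q) ?vs"
    by (simp add: is_cycle_def walk_def walk_length_def)
  moreover have "walk_length ?vs = 6" by (simp add: walk_length_def)
  ultimately show ?thesis by (rule that)
qed

theorem theorem4:
  fixes p q :: nat
  assumes "prime q" and "q \<ge> 3" and "p = (q - 1) div 2" and "odd p"
  shows "zrg_mixed_graph ((p + 1) div 2) q 6 (Gpq p q)"
proof -
  \<comment> \<open>The division defining \<open>p\<close> is truncated; oddness of \<open>q\<close>
    recovers \<open>q = 2 * p + 1\<close>.\<close>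
  have "odd q" using prime_odd_nat assms(1,2) by force
  then have q: "q = 2 * p + 1" using assms(3) by (auto elim!: oddE)
  obtain vs where vs: "is_cycle (Gpq p q) vs" "walk_length vs = 6"
    using ex_6_cycle[OF assms(2)] .
  have "girth (Gpq p q) = enat 6"
    unfolding girth_def
  proof (rule antisym)
    show "(INF vs\<in>{vs. is_cycle (Gpq p q) vs}. enat (walk_length vs)) \<le> enat 6"
      by (rule INF_lower2[of vs]) (use vs in simp_all)
    show "enat 6 \<le> (INF vs\<in>{vs. is_cycle (Gpq p q) vs}. enat (walk_length vs))"
      by (rule INF_greatest) (use cycle_length_ge_6[OF assms(1,4) q] in simp)
  qed
  moreover have "mixed_graph (Gpq p q)"
    by (rule mixed_graph_Gpq) (use assms in simp_all)
  ultimately show ?thesis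
    using card_arcs[OF assms(4) q] card_incident_edges_Gpq[of q _ p] assms(2)
    by (simp add: zrg_mixed_graph_def)
qed

end
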